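(* Suppose the standing Assumption below holds, and let $\mathcal{F}\subseteq 2^U$ be downward closed. Let $\lambda^*$ be a classifier in $\mathcal{C}$ satisfying properties (P1')–(P3') below. Then the better of the two solutions (a) the maximum-profit set in $\mathcal{F}$ containing only elements of $U^\circ_{\lambda^*}$, and (b) the best single element of $U_{\lambda^*}$, has profit at least $\pi(x')/(2d+1)$ for every $x'\in\mathrm{Conv}(\mathcal{F})\subseteq[0,1]^n$.
   Context: Items $e\in U$, $|U|=n$, have values $v(e)\ge0$ and sizes $s(e)\in\mathbb{R}^d_{\ge0}$; $S$ has the sizes as columns; $\pi(x)=\langle v,x\rangle-g(Sx)$ for $x\in[0,1]^n$, sets identified with indicator vectors; $\mathrm{opt}=\max_{A\in\mathcal{F}}\pi(A)$. Standing Assumption: $g:\mathbb{R}^d_{\ge0}\to\mathbb{R}_{\ge0}$ is non-decreasing, strictly convex, closed, differentiable, $g(0)=0$, supermodular, with gradients tending to $+\infty$ along every positive direction; items are in general position (in particular for each $\lambda$ at most one item has $v(e)=\langle\lambda,s(e)\rangle$); no item is exceptional ($\arg\max_{\theta\in[0,1]}\{\theta v(e)-g(\theta s(e))\}\in(0,1)$ defines exceptional); each item has $\pi(\{e\})\le\mathrm{opt}/(\eta d)$, $\eta\ge10^4$. For $\lambda\in\mathbb{R}^d_{\ge0}$: $U_\lambda=\{e:v(e)\ge\langle\lambda,s(e)\rangle\}$, $U^\circ_\lambda=\{e:v(e)>\langle\lambda,s(e)\rangle\}$. With $g_i(t)=g(t\mathbf{e}_i)$, $g_i^\star(u)=\sup_{t\ge0}(ut-g_i(t))$,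 the curve $\mathcal{C}$ is the union of $\{\lambda(\tau):\tau>0\}$ ($\lambda(\tau)$ the unique vector with $g_i^\star(\lambda_i(\tau))=\tau\ \forall i$) with a monotone curve from $0$ to $(g_1'(0),\dots,g_d'(0))$. (P1') For every $x\in\mathcal{F}$ with support in $U^\circ_\lambda$, $\nabla g(Sx)\le\lambda$. (P2') There exist $x^{occ}\in\mathcal{F}$ with support in $U_\lambda$ and an index $i^*$ with $(\nabla g(Sx^{occ}))_{i^*}\ge\lambda_{i^*}$. (P3') $g_i^\star(\lambda_i)=g_j^\star(\lambda_j)$ for all $i,j$. *)

theory Defs
  imports "HOL-Analysis.Analysis"
begin

text \<open>
  Items are the elements of the finite type \<open>'n\<close>; their values form the vector
  \<open>v :: real^'n\<close>, and their sizes are the columns of the matrix \<open>S :: real^'n^'d\<close>.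
  The order on vectors is the componentwise one. A cost \<open>g\<close> is a function on all of
  \<open>real^'d\<close>, but only its values on the non-negative orthant are ever used.
\<close>

definition orthant :: "(real^'d) set" where
  "orthant = {y. 0 \<le> y}"

text \<open>Differentiability, and hence the gradient, is relative to the orthant: on its boundary
  the partial derivatives are one-sided.\<close>

definition grad :: "(real^'d \<Rightarrow> real) \<Rightarrow> real^'d \<Rightarrow> real^'d" where
  "grad g y = (\<chi> i. frechet_derivative g (at y within orthant) (axis i 1))"

definition strictly_convex_on :: "'a::real_vector set \<Rightarrow> ('a \<Rightarrow> real) \<Rightarrow> bool" where
  "strictly_convex_on A f \<longleftrightarrow> convex A \<and>
     (\<forall>x\<in>A. \<forall>y\<in>A. \<forall>t. x \<noteq> y \<and> 0 < t \<and> t < 1 \<longrightarrow>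
        f ((1 - t) *\<^sub>R x + t *\<^sub>R y) < (1 - t) * f x + t * f y)"

definition supermodular_on :: "(real^'d) set \<Rightarrow> (real^'d \<Rightarrow> real) \<Rightarrow> bool" where
  "supermodular_on A f \<longleftrightarrow> (\<forall>x\<in>A. \<forall>y\<in>A. f x + f y \<le> f (sup x y) + f (inf x y))"

text \<open>A convex function is closed if its epigraph is. The last clause says that the derivative
  along the ray from \<open>0\<close> in every direction \<open>u \<ge> 0\<close>, \<open>u \<noteq> 0\<close>, tends to infinity. (Individual
  coordinates of the gradient need not diverge along a coordinate axis: for separable \<open>g\<close> the
  other coordinates stay constant.)\<close>

definition admissible_cost :: "(real^'d \<Rightarrow> real) \<Rightarrow> bool" where
  "admissible_cost g \<longleftrightarrow>
     (\<forall>y\<in>orthant. 0 \<le> g y) \<and>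
     mono_on orthant g \<and>
     strictly_convex_on orthant g \<and>
     closed (epigraph orthant g) \<and>
     g differentiable_on orthant \<and>
     g 0 = 0 \<and>
     supermodular_on orthant g \<and>
     (\<forall>u\<in>orthant. u \<noteq> 0 \<longrightarrow>
        filterlim (\<lambda>t. grad g (t *\<^sub>R u) \<bullet> u) at_top at_top)"

definition axis_cost :: "(real^'d \<Rightarrow> real) \<Rightarrow> 'd \<Rightarrow> real \<Rightarrow> real" where
  "axis_cost g i t = g (axis i t)"

text \<open>For an admissible cost the supremum is over a set that is bounded above.\<close>

definition axis_conj :: "(real^'d \<Rightarrow> real) \<Rightarrow> 'd \<Rightarrow> real \<Rightarrow> real" where
  "axis_conj g i u = (SUP t\<in>{0..}. u * t - axis_cost g i t)"

definition curve_point :: "(real^'d \<Rightarrow> real) \<Rightarrow> real \<Rightarrow> real^'d" where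
  "curve_point g \<tau> = (THE l. \<forall>i. axis_conj g i (l $ i) = \<tau>)"

text \<open>The vector of the one-sided derivatives \<open>g_i'(0)\<close>.\<close>

definition axis_deriv0 :: "(real^'d \<Rightarrow> real) \<Rightarrow> real^'d" where
  "axis_deriv0 g = (\<chi> i. vector_derivative (axis_cost g i) (at 0 within {0..}))"

definition initial_curve :: "(real^'d \<Rightarrow> real) \<Rightarrow> (real \<Rightarrow> real^'d) \<Rightarrow> bool" where
  "initial_curve g \<gamma> \<longleftrightarrow> path \<gamma> \<and> mono_on {0..1} \<gamma> \<and>
     pathstart \<gamma> = 0 \<and> pathfinish \<gamma> = axis_deriv0 g"

definition classifier_curve ::
    "(real^'d \<Rightarrow> real) \<Rightarrow> (real \<Rightarrow> real^'d) \<Rightarrow> (real^'d) set" where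
  "classifier_curve g \<gamma> = path_image \<gamma> \<union> curve_point g ` {0<..}"

definition indvec :: "'n set \<Rightarrow> real^'n" where
  "indvec A = (\<chi> e. indicator A e)"

definition profit :: "real^'n \<Rightarrow> real^'n^'d \<Rightarrow> (real^'d \<Rightarrow> real) \<Rightarrow> real^'n \<Rightarrow> real" where
  "profit v S g x = v \<bullet> x - g (S *v x)"

abbreviation set_profit ::
    "real^'n \<Rightarrow> real^'n^'d \<Rightarrow> (real^'d \<Rightarrow> real) \<Rightarrow> 'n set \<Rightarrow> real" where
  "set_profit v S g A \<equiv> profit v S g (indvec A)"

definition opt ::
    "real^'n \<Rightarrow> real^'n^'d \<Rightarrow> (real^'d \<Rightarrow> real) \<Rightarrow> 'n set set \<Rightarrow> real" where
  "opt v S g F = Max (set_profit v S g ` F)"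

definition downward_closed :: "'n set set \<Rightarrow> bool" where
  "downward_closed F \<longleftrightarrow> (\<forall>A\<in>F. \<forall>B. B \<subseteq> A \<longrightarrow> B \<in> F)"

definition upper_items :: "real^'n \<Rightarrow> real^'n^'d \<Rightarrow> real^'d \<Rightarrow> 'n set" where
  "upper_items v S l = {e. v $ e \<ge> l \<bullet> column e S}"

definition strict_upper_items :: "real^'n \<Rightarrow> real^'n^'d \<Rightarrow> real^'d \<Rightarrow> 'n set" where
  "strict_upper_items v S l = {e. v $ e > l \<bullet> column e S}"

text \<open>By strict convexity the maximiser is unique unless the item has size \<open>0\<close>; only an item of
  size and value \<open>0\<close> has several, and it does not count as exceptional here.\<close>

definition exceptional ::
    "real^'n \<Rightarrow> real^'n^'d \<Rightarrow> (real^'d \<Rightarrow> real) \<Rightarrow> 'n \<Rightarrow> bool" where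
  "exceptional v S g e \<longleftrightarrow>
     {\<theta>. is_arg_max (\<lambda>\<theta>. \<theta> * v $ e - g (\<theta> *\<^sub>R column e S)) (\<lambda>\<theta>. \<theta> \<in> {0..1}) \<theta>}
       \<subseteq> {0<..<1}"

text \<open>Ties are excluded for the classifiers on a given curve \<open>C\<close> only. Excluding them for
  all \<open>l \<ge> 0\<close> would not be a genericity condition when \<open>d \<ge> 2\<close>, since the tie hyperplanes of two
  items in general meet inside the orthant.\<close>

definition general_position :: "real^'n \<Rightarrow> real^'n^'d \<Rightarrow> (real^'d) set \<Rightarrow> bool" where
  "general_position v S C \<longleftrightarrow> (\<forall>l\<in>C. card {e. v $ e = l \<bullet> column e S} \<le> 1)"

definition standing_assumption ::
    "real^'n \<Rightarrow> real^'n^'d \<Rightarrow> (real^'d \<Rightarrow> real) \<Rightarrow> 'n set set \<Rightarrow> (real^'d) set \<Rightarrow> real \<Rightarrow> bool"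
  where
  "standing_assumption v S g F C \<eta> \<longleftrightarrow>
     admissible_cost g \<and>
     general_position v S C \<and>
     (\<forall>e. \<not> exceptional v S g e) \<and>
     \<eta> \<ge> 10 ^ 4 \<and>
     (\<forall>e. set_profit v S g {e} \<le> opt v S g F / (\<eta> * real CARD('d)))"

definition P1 ::
    "real^'n \<Rightarrow> real^'n^'d \<Rightarrow> (real^'d \<Rightarrow> real) \<Rightarrow> 'n set set \<Rightarrow> real^'d \<Rightarrow> bool" where
  "P1 v S g F l \<longleftrightarrow>
     (\<forall>A\<in>F. A \<subseteq> strict_upper_items v S l \<longrightarrow> grad g (S *v indvec A) \<le> l)"

definition P2 ::
    "real^'n \<Rightarrow> real^'n^'d \<Rightarrow> (real^'d \<Rightarrow> real) \<Rightarrow> 'n set set \<Rightarrow> real^'d \<Rightarrow> bool" where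
  "P2 v S g F l \<longleftrightarrow>
     (\<exists>A\<in>F. A \<subseteq> upper_items v S l \<and> (\<exists>i. grad g (S *v indvec A) $ i \<ge> l $ i))"

definition P3 :: "(real^'d \<Rightarrow> real) \<Rightarrow> real^'d \<Rightarrow> bool" where
  "P3 g l \<longleftrightarrow> (\<forall>i j. axis_conj g i (l $ i) = axis_conj g j (l $ j))"

text \<open>The sets compared by the two solutions: the feasible sets of strictly upper items, and the
  feasible single upper items. Their union has the better of the two solutions as its best member,
  also when there is no feasible single upper item and only the first solution exists.\<close>

definition candidates ::
    "real^'n \<Rightarrow> real^'n^'d \<Rightarrow> 'n set set \<Rightarrow> real^'d \<Rightarrow> 'n set set" where
  "candidates v S F l =
     {A \<in> F. A \<subseteq> strict_upper_items v S l} \<union> {{e} |e. e \<in> upper_items v S l \<and> {e} \<in> F}"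

end

theory Submission
  imports Defs
begin

text \<open>
  Lagrangian duality with the price vector \<open>l\<close>: for \<open>y \<ge> 0\<close>, superadditivity of \<open>g\<close> along the
  coordinates gives \<open>l \<bullet> y - g y \<le> (\<Sum>i. g\<^sub>i\<^sup>\<star> (l\<^sub>i)) = d \<tau>\<close>, so \<open>profit x'\<close> is at most the reduced
  value \<open>v \<bullet> x' - l \<bullet> S x'\<close> plus \<open>d \<tau>\<close>. The reduced value is linear, hence bounded by its value
  on a feasible set of strictly upper items, and on such a set it is at most the profit because
  the gradient there is at most \<open>l\<close>.

  To bound \<open>\<tau>\<close>, remove the only item \<open>e\<close> from the set of (P2') that is not strictly upper and add it
  back continuously. At some fraction \<open>t\<close> the cost at the resulting load \<open>y\<close> has slope at least
  \<open>l\<^sub>j\<close> along some axis \<open>j\<close>, but slope at most \<open>l \<bullet> y\<close> along the ray through \<open>y\<close>. The tangent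
  hyperplane at \<open>y\<close> then shows \<open>\<tau> = g\<^sub>j\<^sup>\<star> (l\<^sub>j) \<le> l \<bullet> y - g y\<close>, which is at most the profit of the
  fractional set. By superadditivity this is at most the profit of the remaining set plus that of the
  fraction of \<open>e\<close>, and as \<open>e\<close> is not exceptional, the latter is at most \<open>max 0 (profit {e})\<close>.
  Hence \<open>\<tau>\<close> is at most twice the profit of the better solution.
\<close>

section \<open>Convexity along segments\<close>

lemma strictly_convex_on_imp_convex_on:
  assumes "strictly_convex_on A f"
  shows "convex_on A f"
proof (rule convex_onI)
  show "convex A" using assms by (simp add: strictly_convex_on_def)
next
  fix t :: real and x y
  assume "0 < t" "t < 1" "x \<in> A" "y \<in> A"
  then show "f ((1 - t) *\<^sub>R x + t *\<^sub>R y) \<le> (1 - t) * f x + t * f y"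
    using assms
    by (cases "x = y") (auto simp: strictly_convex_on_def algebra_simps intro: less_imp_le)
qed

text \<open>The two inner points lie on one segment with complementary weights, so their chord
  bounds add up to the sum of the endpoint values.\<close>

lemma convex_on_increasing_difference:
  fixes f :: "'a::real_vector \<Rightarrow> real"
  assumes f: "convex_on A f" and x: "x \<in> A" "x + (p + q) *\<^sub>R w \<in> A" and pq: "0 \<le> p" "0 \<le> q"
  shows "f (x + p *\<^sub>R w) + f (x + q *\<^sub>R w) \<le> f x + f (x + (p + q) *\<^sub>R w)"
proof (cases "p + q = 0")
  case True
  then have "p = 0" "q = 0" using pq by auto
  then show ?thesis by simp
next
  case False
  have between: "f (x + r *\<^sub>R w) \<le> (1 - r / (p + q)) * f x + r / (p + q) * f (x + (p + q) *\<^sub>R w)"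
    if "0 \<le> r" "r \<le> p + q" for r
  proof -
    have "(1 - r / (p + q)) *\<^sub>R x + (r / (p + q)) *\<^sub>R (x + (p + q) *\<^sub>R w) = x + r *\<^sub>R w"
      using False by (simp add: scaleR_right_distrib scaleR_left_diff_distrib)
    moreover have "0 \<le> r / (p + q)" "r / (p + q) \<le> 1"
      using that False by (auto simp: divide_le_eq_1)
    ultimately show ?thesis
      using convex_onD[OF f, of "r / (p + q)" x "x + (p + q) *\<^sub>R w"] x by simp
  qed
  define c where "c = p / (p + q)"
  have c: "p / (p + q) = c" "q / (p + q) = 1 - c"
    using False by (simp_all add: c_def field_simps)
  show ?thesis
    using between[of p] between[of q] pq unfolding c by (simp add: left_diff_distrib)
qed

section \<open>The orthant, increasing differences and superadditivity\<close>

lemma mem_orthant_iff: "y \<in> orthant \<longleftrightarrow> (\<forall>i. 0 \<le> y $ i)"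
  by (simp add: orthant_def less_eq_vec_def)

lemma convex_orthant: "convex orthant"
  by (auto simp: convex_def mem_orthant_iff)

lemma orthant_add: "x \<in> orthant \<Longrightarrow> y \<in> orthant \<Longrightarrow> x + y \<in> orthant"
  by (simp add: mem_orthant_iff)

lemma orthant_scaleR: "0 \<le> c \<Longrightarrow> x \<in> orthant \<Longrightarrow> c *\<^sub>R x \<in> orthant"
  by (simp add: mem_orthant_iff)

lemma orthant_axis: "0 \<le> t \<Longrightarrow> axis i t \<in> orthant"
  by (simp add: mem_orthant_iff axis_def)

lemma axis_eq_scaleR: "axis i t = (t::real) *\<^sub>R axis i 1"
  by (simp add: vec_eq_iff axis_def)

text \<open>Raising the base point in the coordinates other than \<open>k\<close> uses supermodularity, raising it in
  coordinate \<open>k\<close> uses convexity.\<close>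

lemma supermodular_convex_increasing_difference_axis:
  fixes g :: "real^'d \<Rightarrow> real"
  assumes "convex_on orthant g" "supermodular_on orthant g"
    and a: "a \<in> orthant" "a \<le> a'" and h: "0 \<le> h"
  shows "g (a + axis k h) - g a \<le> g (a' + axis k h) - g a'"
proof -
  \<comment> \<open>Intermediate base point: coordinate \<open>k\<close> as in \<open>a\<close>, all
    others as in \<open>a'\<close>.\<close>
  define b where "b = a' - axis k (a' $ k - a $ k)"
  have le: "a $ i \<le> a' $ i" "0 \<le> a $ i" for i
    using a by (auto simp: less_eq_vec_def mem_orthant_iff)
  have b: "b $ i = (if i = k then a $ k else a' $ i)" for i
    by (simp add: b_def axis_def)
  have orth: "b \<in> orthant" "a + axis k h \<in> orthant" "a' + axis k h \<in> orthant"
    using le h order_trans[OF le(2) le(1)] by (auto simp: mem_orthant_iff b axis_def)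
  have "sup (a + axis k h) b = b + axis k h" "inf (a + axis k h) b = a"
    using le h by (auto simp: vec_eq_iff sup_vec_def inf_vec_def b axis_def sup_real_def
        inf_real_def max_def min_def intro: antisym)
  then have 1: "g (a + axis k h) + g b \<le> g (b + axis k h) + g a"
    using assms(2) orth unfolding supermodular_on_def by metis
  have *: "b + h *\<^sub>R axis k 1 = b + axis k h" "b + (a' $ k - a $ k) *\<^sub>R axis k 1 = a'"
    "b + (h + (a' $ k - a $ k)) *\<^sub>R axis k 1 = a' + axis k h"
    by (auto simp: vec_eq_iff b axis_def)
  have "g (b + axis k h) + g a' \<le> g b + g (a' + axis k h)"
    using convex_on_increasing_difference[OF assms(1), of b h "a' $ k - a $ k" "axis k 1"]
      orth h le[of k] unfolding * by simp
  with 1 show ?thesis by simp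
qed

text \<open>The increment \<open>b\<close> is added one coordinate at a time, and the axis
  increments telescope.\<close>

lemma supermodular_convex_increasing_difference:
  fixes g :: "real^'d \<Rightarrow> real"
  assumes g: "convex_on orthant g" "supermodular_on orthant g"
    and a: "a \<in> orthant" "a \<le> a'" and b: "b \<in> orthant"
  shows "g (a + b) - g a \<le> g (a' + b) - g a'"
proof -
  have "g (a + (\<Sum>i\<in>K. axis i (b $ i))) - g a \<le> g (a' + (\<Sum>i\<in>K. axis i (b $ i))) - g a'"
    if "finite K" for K :: "'d set"
    using that
  proof induction
    case empty
    show ?case by simp
  next
    case (insert k K)
    let ?s = "\<Sum>i\<in>K. axis i (b $ i)"
    have "?s \<in> orthant"
      using b by (auto simp: mem_orthant_iff axis_def intro!: sum_nonneg)
    then have "g ((a + ?s) + axis k (b $ k)) - g (a + ?s)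
        \<le> g ((a' + ?s) + axis k (b $ k)) - g (a' + ?s)"
      using a b by (intro supermodular_convex_increasing_difference_axis g orthant_add)
        (auto simp: mem_orthant_iff)
    with insert show ?case by (simp add: algebra_simps)
  qed
  moreover have "(\<Sum>i\<in>UNIV. axis i (b $ i)) = b"
    by (simp add: vec_eq_iff axis_def)
  ultimately show ?thesis by (metis finite)
qed

text \<open>Adding \<open>b\<close> costs at least as much from base \<open>a\<close> as from base
  \<open>0\<close>.\<close>

lemma supermodular_convex_superadditive:
  fixes g :: "real^'d \<Rightarrow> real"
  assumes "convex_on orthant g" "supermodular_on orthant g" "g 0 = 0"
    and "a \<in> orthant" "b \<in> orthant"
  shows "g a + g b \<le> g (a + b)"
  using supermodular_convex_increasing_difference[OF assms(1,2), of 0 a b] assms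
  by (simp add: orthant_def)

text \<open>Superadditivity splits off one axis component at a time. The separable minorant lets the
  dual bound decouple into coordinates.\<close>

lemma sum_axis_cost_le:
  fixes g :: "real^'d \<Rightarrow> real"
  assumes g: "convex_on orthant g" "supermodular_on orthant g" "g 0 = 0" and y: "y \<in> orthant"
  shows "(\<Sum>i\<in>UNIV. axis_cost g i (y $ i)) \<le> g y"
proof -
  have "(\<Sum>i\<in>K. axis_cost g i (y $ i)) \<le> g (\<Sum>i\<in>K. axis i (y $ i))"
    if "finite K" for K :: "'d set"
    using that
  proof induction
    case empty
    show ?case by (simp add: g)
  next
    case (insert k K)
    have "(\<Sum>i\<in>K. axis i (y $ i)) \<in> orthant" "axis k (y $ k) \<in> orthant"
      using y by (auto simp: mem_orthant_iff axis_def intro!: sum_nonneg)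
    then have "g (axis k (y $ k)) + g (\<Sum>i\<in>K. axis i (y $ i))
        \<le> g (axis k (y $ k) + (\<Sum>i\<in>K. axis i (y $ i)))"
      by (intro supermodular_convex_superadditive g)
    then show ?case using insert by (simp add: axis_cost_def)
  qed
  moreover have "(\<Sum>i\<in>UNIV. axis i (y $ i)) = y"
    by (simp add: vec_eq_iff axis_def)
  ultimately show ?thesis by (metis finite)
qed

section \<open>One-sided gradients and the tangent inequality\<close>

text \<open>A linear map is determined by its values on the axes, so \<open>grad\<close> represents
  whichever derivative \<open>frechet_derivative\<close> selects, also on the boundary.\<close>

lemma has_derivative_grad:
  fixes g :: "real^'d \<Rightarrow> real"
  assumes "g differentiable_on orthant" "y \<in> orthant"
  shows "(g has_derivative (\<lambda>w. grad g y \<bullet> w)) (at y within orthant)"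
proof -
  let ?D = "frechet_derivative g (at y within orthant)"
  have D: "(g has_derivative ?D) (at y within orthant)"
    using assms by (simp add: differentiable_on_def frechet_derivative_works)
  then have lin: "linear ?D"
    by (rule has_derivative_linear)
  have "?D w = grad g y \<bullet> w" for w
  proof -
    have "?D w = ?D (\<Sum>i\<in>UNIV. (w $ i) *\<^sub>R axis i 1)"
      by (rule arg_cong[where f = ?D]) (simp add: vec_eq_iff axis_def if_distrib cong: if_cong)
    also have "\<dots> = (\<Sum>i\<in>UNIV. w $ i * ?D (axis i 1))"
      by (simp add: linear_sum[OF lin] linear_scale[OF lin])
    also have "\<dots> = grad g y \<bullet> w"
      by (simp add: grad_def inner_vec_def mult.commute)
    finally show ?thesis .
  qed
  then have "?D = (\<lambda>w. grad g y \<bullet> w)" by auto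
  with D show ?thesis by metis
qed

lemma grad_segment_tendsto:
  fixes g :: "real^'d \<Rightarrow> real"
  assumes g: "g differentiable_on orthant" and yz: "y \<in> orthant" "z \<in> orthant"
  shows "((\<lambda>t. (g (y + t *\<^sub>R (z - y)) - g y) / t) \<longlongrightarrow> grad g y \<bullet> (z - y)) (at 0 within {0..1})"
proof -
  let ?seg = "\<lambda>t::real. y + t *\<^sub>R (z - y)"
  have "?seg t \<in> orthant" if "t \<in> {0..1}" for t
  proof -
    have "?seg t = (1 - t) *\<^sub>R y + t *\<^sub>R z" by (simp add: algebra_simps)
    then show ?thesis using yz that by (simp add: orthant_add orthant_scaleR)
  qed
  then have "(g has_derivative (\<lambda>w. grad g y \<bullet> w)) (at (?seg 0) within ?seg ` {0..1})"
    using has_derivative_grad[OF g yz(1)] by (auto intro: has_derivative_subset)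
  moreover have "(?seg has_derivative (\<lambda>t. t *\<^sub>R (z - y))) (at 0 within {0..1})"
    by (auto intro!: derivative_eq_intros)
  ultimately have "((\<lambda>t. g (?seg t)) has_derivative (\<lambda>t. grad g y \<bullet> (t *\<^sub>R (z - y))))
      (at 0 within {0..1})"
    by (rule has_derivative_in_compose[rotated])
  then have "((\<lambda>t. g (?seg t)) has_real_derivative grad g y \<bullet> (z - y)) (at 0 within {0..1})"
    by (simp add: has_field_derivative_def mult_commute_abs)
  then show ?thesis by (simp add: has_field_derivative_iff)
qed

text \<open>Lower bounds on difference quotients pass to the limit. This turns slope conditions on
  the values of \<open>g\<close> back into bounds on its gradient.\<close>

lemma grad_segment_ge:
  fixes g :: "real^'d \<Rightarrow> real"
  assumes "g differentiable_on orthant" "y \<in> orthant" "z \<in> orthant"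
    and c: "\<And>t. 0 < t \<Longrightarrow> t \<le> 1 \<Longrightarrow> g y + t * c \<le> g (y + t *\<^sub>R (z - y))"
  shows "c \<le> grad g y \<bullet> (z - y)"
proof -
  have "c \<le> (g (y + t *\<^sub>R (z - y)) - g y) / t" if "0 < t" "t \<le> 1" for t
    using c[OF that] that by (simp add: pos_le_divide_eq mult.commute)
  then have "\<forall>\<^sub>F t in at 0 within {0..1}. c \<le> (g (y + t *\<^sub>R (z - y)) - g y) / t"
    unfolding eventually_at_filter by (intro always_eventually) auto
  then show ?thesis
    using tendsto_lowerbound[OF grad_segment_tendsto[OF assms(1-3)]]
    by (simp add: trivial_limit_within islimpt_Icc)
qed

text \<open>By convexity no difference quotient along the segment exceeds \<open>g z - g y\<close>;
  the limit gives the tangent inequality.\<close>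

lemma grad_segment_le:
  fixes g :: "real^'d \<Rightarrow> real"
  assumes g: "convex_on orthant g" and gd: "g differentiable_on orthant"
    and yz: "y \<in> orthant" "z \<in> orthant"
  shows "g y + grad g y \<bullet> (z - y) \<le> g z"
proof -
  have "(g (y + t *\<^sub>R (z - y)) - g y) / t \<le> g z - g y" if "0 < t" "t \<le> 1" for t
  proof -
    have "y + t *\<^sub>R (z - y) = (1 - t) *\<^sub>R y + t *\<^sub>R z" by (simp add: algebra_simps)
    then have "g (y + t *\<^sub>R (z - y)) \<le> (1 - t) * g y + t * g z"
      using convex_onD[OF g, of t y z] yz that by simp
    then have "g (y + t *\<^sub>R (z - y)) - g y \<le> (g z - g y) * t"
      by (simp add: algebra_simps)
    then show ?thesis using that by (simp add: pos_divide_le_eq)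
  qed
  then have "\<forall>\<^sub>F t in at 0 within {0..1}. (g (y + t *\<^sub>R (z - y)) - g y) / t \<le> g z - g y"
    unfolding eventually_at_filter by (intro always_eventually) auto
  then have "grad g y \<bullet> (z - y) \<le> g z - g y"
    using tendsto_upperbound[OF grad_segment_tendsto[OF gd yz]]
    by (simp add: trivial_limit_within islimpt_Icc)
  then show ?thesis by simp
qed

section \<open>Slope conditions and their crossing point\<close>

text \<open>The two properties of \<open>y\<close> say that the gradient \<open>p\<close> at \<open>y\<close> satisfies \<open>p \<bullet> y \<le> l \<bullet> y\<close> and
  \<open>l\<^sub>j \<le> p\<^sub>j\<close>. Unlike these, they pass to limits without continuity of the gradient.\<close>

definition radial_slope_le :: "(real^'d \<Rightarrow> real) \<Rightarrow> real^'d \<Rightarrow> real^'d \<Rightarrow> bool" where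
  "radial_slope_le g l y \<longleftrightarrow> (\<forall>r\<in>{0..1}. g y - (1 - r) * (l \<bullet> y) \<le> g (r *\<^sub>R y))"

definition axis_slope_ge :: "(real^'d \<Rightarrow> real) \<Rightarrow> real^'d \<Rightarrow> 'd \<Rightarrow> real^'d \<Rightarrow> bool" where
  "axis_slope_ge g l j y \<longleftrightarrow> (\<forall>h\<in>{0..}. g y + h * l $ j \<le> g (y + axis j h))"

lemma radial_slope_leI:
  fixes g :: "real^'d \<Rightarrow> real"
  assumes "convex_on orthant g" "g differentiable_on orthant" "y \<in> orthant"
    and "grad g y \<le> l"
  shows "radial_slope_le g l y"
  unfolding radial_slope_le_def
proof
  fix r :: real assume r: "r \<in> {0..1}"
  have "grad g y \<bullet> y \<le> l \<bullet> y"
    unfolding inner_vec_def using assms(3,4)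
    by (auto intro!: sum_mono mult_right_mono simp: less_eq_vec_def mem_orthant_iff)
  then have "(1 - r) * (grad g y \<bullet> y) \<le> (1 - r) * (l \<bullet> y)"
    using r by (intro mult_left_mono) auto
  moreover have "g y + grad g y \<bullet> (r *\<^sub>R y - y) \<le> g (r *\<^sub>R y)"
    using assms r by (intro grad_segment_le orthant_scaleR) auto
  ultimately show "g y - (1 - r) * (l \<bullet> y) \<le> g (r *\<^sub>R y)"
    by (simp add: inner_diff_right algebra_simps)
qed

lemma axis_slope_geI:
  fixes g :: "real^'d \<Rightarrow> real"
  assumes "convex_on orthant g" "g differentiable_on orthant" "y \<in> orthant"
    and "l $ j \<le> grad g y $ j"
  shows "axis_slope_ge g l j y"
  unfolding axis_slope_ge_def
proof
  fix h :: real assume h: "h \<in> {0..}"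
  have "g y + grad g y \<bullet> (y + axis j h - y) \<le> g (y + axis j h)"
    using assms h by (intro grad_segment_le orthant_add orthant_axis) auto
  moreover have "h * l $ j \<le> h * grad g y $ j"
    using assms(4) h by (intro mult_left_mono) auto
  ultimately show "g y + h * l $ j \<le> g (y + axis j h)"
    by (simp add: inner_axis mult.commute)
qed

text \<open>For each fixed \<open>r\<close> or \<open>h\<close> the condition on \<open>t\<close> is
  a non-strict inequality between continuous functions, so each set is an intersection of closed
  sets.\<close>

lemma closed_slope_conditions:
  fixes g :: "real^'d \<Rightarrow> real"
  assumes cont: "continuous_on orthant g" and ab: "a \<in> orthant" "b \<in> orthant"
  shows "closed {t\<in>{0..1}. radial_slope_le g l (a + t *\<^sub>R b)}"
    and "closed {t\<in>{0..1}. axis_slope_ge g l j (a + t *\<^sub>R b)}"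
proof -
  have comp: "continuous_on {0..1} (\<lambda>t. g (k t))"
    if "continuous_on {0..1} k" "\<And>t. t \<in> {0..1} \<Longrightarrow> k t \<in> orthant" for k :: "real \<Rightarrow> real^'d"
    using that by (intro continuous_on_compose2[OF cont]) auto
  have "{t\<in>{0..1}. radial_slope_le g l (a + t *\<^sub>R b)} =
      {0..1} \<inter> (\<Inter>r\<in>{0..1}. {t\<in>{0..1}. g (a + t *\<^sub>R b) - (1 - r) * (l \<bullet> (a + t *\<^sub>R b))
        \<le> g (r *\<^sub>R (a + t *\<^sub>R b))})"
    by (auto simp: radial_slope_le_def)
  moreover have "closed \<dots>"
    using ab by (intro closed_Int closed_INT ballI continuous_on_closed_Collect_le continuous_intros
        closed_atLeastAtMost comp orthant_scaleR orthant_add) auto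
  ultimately show "closed {t\<in>{0..1}. radial_slope_le g l (a + t *\<^sub>R b)}" by metis
  have "{t\<in>{0..1}. axis_slope_ge g l j (a + t *\<^sub>R b)} =
      {0..1} \<inter> (\<Inter>h\<in>{0..}. {t\<in>{0..1}. g (a + t *\<^sub>R b) + h * l $ j
        \<le> g (a + t *\<^sub>R b + axis j h)})"
    by (auto simp: axis_slope_ge_def)
  moreover have "closed \<dots>"
    using ab by (intro closed_Int closed_INT ballI continuous_on_closed_Collect_le continuous_intros
        closed_atLeastAtMost comp orthant_scaleR orthant_add orthant_axis) auto
  ultimately show "closed {t\<in>{0..1}. axis_slope_ge g l j (a + t *\<^sub>R b)}" by metis
qed

text \<open>The two conditions define closed sets that cover \<open>[0, 1]\<close>, so they meet by connectedness.\<close>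

lemma exists_slope_crossing:
  fixes g :: "real^'d \<Rightarrow> real"
  assumes g: "convex_on orthant g" "g differentiable_on orthant"
    and ab: "a \<in> orthant" "b \<in> orthant"
    and start: "grad g a \<le> l" and finish: "l $ i \<le> grad g (a + b) $ i"
  obtains t j where "t \<in> {0..1}" "radial_slope_le g l (a + t *\<^sub>R b)"
    "axis_slope_ge g l j (a + t *\<^sub>R b)"
proof -
  let ?y = "\<lambda>t. a + t *\<^sub>R b"
  let ?A = "{t\<in>{0..1}. radial_slope_le g l (?y t)}"
  let ?B = "\<Union>j. {t\<in>{0..1}. axis_slope_ge g l j (?y t)}"
  have y: "?y t \<in> orthant" if "t \<in> {0..1}" for t
    using ab that by (intro orthant_add orthant_scaleR) auto
  have cont: "continuous_on orthant g"
    using g(2) by (rule differentiable_imp_continuous_on)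
  have clA: "closed ?A" and clB: "closed ?B"
    using closed_slope_conditions[OF cont ab] by (auto intro!: closed_UN)
  have cover: "{0..1} \<subseteq> ?A \<union> ?B"
  proof
    fix t :: real assume t: "t \<in> {0..1}"
    show "t \<in> ?A \<union> ?B"
    \<comment> \<open>If no coordinate of the gradient reaches that of \<open>l\<close>, the whole
      gradient is below \<open>l\<close>.\<close>
    proof (cases "\<exists>j. l $ j \<le> grad g (?y t) $ j")
      case True
      then show ?thesis using t axis_slope_geI[OF g y[OF t]] by blast
    next
      case False
      then have "grad g (?y t) \<le> l" by (auto simp: less_eq_vec_def not_le intro: less_imp_le)
      then show ?thesis using t radial_slope_leI[OF g y[OF t]] by blast
    qed
  qed
  have "0 \<in> ?A \<inter> {0..1}" using radial_slope_leI[OF g ab(1) start] by simp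
  moreover have "1 \<in> ?B \<inter> {0..1}" using axis_slope_geI[OF g orthant_add[OF ab] finish] by auto
  ultimately have "?A \<inter> ?B \<inter> {0..1} \<noteq> {}"
    using connected_closedD[OF connected_Icc _ cover clA clB] by blast
  then show ?thesis using that by auto
qed

section \<open>Conjugates of the axis costs and the dual bound\<close>

text \<open>With \<open>p = grad g y\<close>, the two conditions give
  \<open>p \<bullet> y \<le> l \<bullet> y\<close> and \<open>l $ j \<le> p $ j\<close>. The tangent
  at \<open>y\<close>, evaluated on axis \<open>j\<close>, then bounds every term of the
  supremum.\<close>

lemma axis_conj_le:
  fixes g :: "real^'d \<Rightarrow> real"
  assumes g: "convex_on orthant g" "g differentiable_on orthant" and y: "y \<in> orthant"
    and radial: "radial_slope_le g l y" and axis: "axis_slope_ge g l j y"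
  shows "axis_conj g j (l $ j) \<le> l \<bullet> y - g y"
  unfolding axis_conj_def
proof (rule cSUP_least)
  fix s :: real assume s: "s \<in> {0..}"
  have "- (l \<bullet> y) \<le> grad g y \<bullet> (0 - y)"
  proof (rule grad_segment_ge[OF g(2) y])
    show "g y + t * - (l \<bullet> y) \<le> g (y + t *\<^sub>R (0 - y))" if "0 < t" "t \<le> 1" for t
    proof -
      have "(1 - t) *\<^sub>R y = y + t *\<^sub>R (0 - y)" by (simp add: algebra_simps)
      then show ?thesis
        using bspec[OF radial[unfolded radial_slope_le_def], of "1 - t"] that by simp
    qed
  qed (simp add: mem_orthant_iff)
  moreover have "s * l $ j \<le> grad g y \<bullet> ((y + axis j s) - y)"
  proof (rule grad_segment_ge[OF g(2) y])
    show "g y + t * (s * l $ j) \<le> g (y + t *\<^sub>R (y + axis j s - y))" if "0 < t" "t \<le> 1" for t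
    proof -
      have "axis j (t * s) = t *\<^sub>R (y + axis j s - y)" by (simp add: vec_eq_iff axis_def)
      moreover have "t * s \<in> {0..}" using that s by simp
      ultimately show ?thesis
        using bspec[OF axis[unfolded axis_slope_ge_def], of "t * s"] by (simp add: mult.assoc)
    qed
  qed (use y s in \<open>auto intro: orthant_add orthant_axis\<close>)
  moreover have "g y + grad g y \<bullet> (axis j s - y) \<le> g (axis j s)"
    using g y s by (intro grad_segment_le orthant_axis) auto
  ultimately show "l $ j * s - axis_cost g j s \<le> l \<bullet> y - g y"
    by (simp add: axis_cost_def inner_diff_right algebra_simps)
qed simp

text \<open>The point is that the supremum is over a bounded set: since slopes diverge along the
  axis, some tangent has slope at least \<open>u\<close>, and it bounds all terms.\<close>

lemma axis_conj_upper:
  fixes g :: "real^'d \<Rightarrow> real"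
  assumes g: "admissible_cost g" and t: "0 \<le> t"
  shows "u * t - axis_cost g i t \<le> axis_conj g i u"
proof -
  have conv: "convex_on orthant g" and gd: "g differentiable_on orthant"
    using g by (auto simp: admissible_cost_def intro: strictly_convex_on_imp_convex_on)
  have e: "axis i (1::real) \<in> orthant" "axis i (1::real) \<noteq> 0"
    by (auto simp: orthant_axis axis_eq_0_iff)
  then have "filterlim (\<lambda>t. grad g (t *\<^sub>R axis i 1) \<bullet> axis i 1) at_top at_top"
    using g unfolding admissible_cost_def by blast
  then have "\<forall>\<^sub>F T in at_top. u \<le> grad g (T *\<^sub>R axis i 1) \<bullet> axis i 1 \<and> 0 \<le> T"
    by (simp add: filterlim_at_top eventually_ge_at_top eventually_conj)
  then obtain T where T: "u \<le> grad g (T *\<^sub>R axis i 1) \<bullet> axis i 1" "0 \<le> T"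
    using eventually_happens'[OF trivial_limit_at_top_linorder] by blast
  let ?p = "grad g (T *\<^sub>R axis i 1) \<bullet> axis i 1"
  have "u * s - axis_cost g i s \<le> ?p * T - g (T *\<^sub>R axis i 1)" if s: "s \<in> {0..}" for s
  proof -
    have "g (T *\<^sub>R axis i 1) + grad g (T *\<^sub>R axis i 1) \<bullet> (s *\<^sub>R axis i 1 - T *\<^sub>R axis i 1)
        \<le> g (s *\<^sub>R axis i 1)"
      using s T e by (intro grad_segment_le conv gd orthant_scaleR) auto
    moreover have "u * s \<le> ?p * s" using s T by (intro mult_right_mono) auto
    ultimately show ?thesis
      by (simp add: axis_cost_def axis_eq_scaleR[of i s] inner_diff_right algebra_simps)
  qed
  then have "bdd_above ((\<lambda>t. u * t - axis_cost g i t) ` {0..})"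
    by (intro bdd_aboveI2)
  then show ?thesis unfolding axis_conj_def using t by (intro cSUP_upper) auto
qed

text \<open>After \<open>g\<close> is replaced by its separable minorant, this is the Fenchel-Young
  inequality in each coordinate.\<close>

lemma dual_bound:
  fixes g :: "real^'d \<Rightarrow> real"
  assumes g: "admissible_cost g" and y: "y \<in> orthant"
  shows "l \<bullet> y - g y \<le> (\<Sum>i\<in>UNIV. axis_conj g i (l $ i))"
proof -
  have "(\<Sum>i\<in>UNIV. axis_cost g i (y $ i)) \<le> g y"
    using g y by (intro sum_axis_cost_le)
      (auto simp: admissible_cost_def intro: strictly_convex_on_imp_convex_on)
  then have "l \<bullet> y - g y \<le> (\<Sum>i\<in>UNIV. l $ i * y $ i - axis_cost g i (y $ i))"
    by (simp add: inner_vec_def sum_subtractf)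
  also have "\<dots> \<le> (\<Sum>i\<in>UNIV. axis_conj g i (l $ i))"
    using y by (intro sum_mono axis_conj_upper g) (simp add: mem_orthant_iff)
  finally show ?thesis .
qed

section \<open>Loads, indicator vectors and reduced values\<close>

lemma inner_matrix_vector_mult:
  fixes S :: "real^'n^'d"
  shows "l \<bullet> (S *v x) = (\<Sum>e\<in>UNIV. (l \<bullet> column e S) * x $ e)"
  by (simp add: matrix_mult_sum inner_sum_right scalar_mult_eq_scaleR mult.commute)

lemma matrix_vector_mult_orthant:
  fixes S :: "real^'n^'d"
  assumes "\<And>e. 0 \<le> column e S" "0 \<le> x"
  shows "S *v x \<in> orthant"
  using assms by (auto simp: mem_orthant_iff matrix_vector_mult_def column_def less_eq_vec_def
      intro!: sum_nonneg)

lemma indvec_nonneg: "0 \<le> indvec A"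
  by (simp add: indvec_def less_eq_vec_def)

lemma indvec_insert: "e \<notin> A \<Longrightarrow> indvec (insert e A) = indvec A + axis e 1"
  by (auto simp: indvec_def vec_eq_iff axis_def indicator_def)

lemma indvec_singleton: "indvec {e} = axis e 1"
  by (auto simp: indvec_def vec_eq_iff axis_def indicator_def)

text \<open>The radial condition at \<open>r = 0\<close> bounds the cost of the load by its price
  under \<open>l\<close>.\<close>

lemma profit_ge_reduced_value:
  fixes S :: "real^'n^'d"
  assumes "convex_on orthant g" "g differentiable_on orthant" "g 0 = 0"
    and "S *v x \<in> orthant" "grad g (S *v x) \<le> l"
  shows "v \<bullet> x - l \<bullet> (S *v x) \<le> profit v S g x"
  using radial_slope_leI[OF assms(1,2,4,5)] assms(3)
  by (auto simp: radial_slope_le_def profit_def dest: bspec[where x = 0])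

lemma inner_indvec: "w \<bullet> indvec A = (\<Sum>e\<in>A. w $ e)"
  by (simp add: inner_vec_def indvec_def indicator_def if_distrib sum.If_cases cong: if_cong)

lemma linear_le_on_convex_hull:
  fixes c :: "'a::real_inner"
  assumes "\<And>y. y \<in> Y \<Longrightarrow> c \<bullet> y \<le> M" "x \<in> convex hull Y"
  shows "c \<bullet> x \<le> M"
  using hull_minimal[of Y "{y. c \<bullet> y \<le> M}" convex] convex_halfspace_le assms by blast

section \<open>Bounding the reduced value and the conjugates by the better solution\<close>

theorem mainTheorem8:
  fixes v :: "real^'n" and S :: "real^'n^'d" and g :: "real^'d \<Rightarrow> real"
    and F :: "'n set set" and \<gamma> :: "real \<Rightarrow> real^'d" and \<eta> :: real
    and l :: "real^'d" and x' :: "real^'n"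
  assumes "\<And>e. 0 \<le> v $ e"
    and "\<And>e. 0 \<le> column e S"
    and "initial_curve g \<gamma>"
    and "standing_assumption v S g F (classifier_curve g \<gamma>) \<eta>"
    and "downward_closed F"
    and "l \<in> classifier_curve g \<gamma>"
    and "P1 v S g F l"
    and "P2 v S g F l"
    and "P3 g l"
    and "x' \<in> convex hull (indvec ` F)"
  shows "Max (set_profit v S g ` candidates v S F l) \<ge> profit v S g x' / (2 * real CARD('d) + 1)"
proof -
  define M where "M = Max (set_profit v S g ` candidates v S F l)"
  have sizes: "\<And>e. column e S \<in> orthant" using assms(2) by (simp add: orthant_def)
  have g: "admissible_cost g" and nexc: "\<And>e. \<not> exceptional v S g e"
    using assms(4) by (auto simp: standing_assumption_def)
  then have conv: "convex_on orthant g" and gd: "g differentiable_on orthant"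
    and g0: "g 0 = 0" and sm: "supermodular_on orthant g"
    by (auto simp: admissible_cost_def intro: strictly_convex_on_imp_convex_on)
  have load: "S *v indvec A \<in> orthant" for A
    by (rule matrix_vector_mult_orthant[OF assms(2) indvec_nonneg])
  have candM: "set_profit v S g A \<le> M" if "A \<in> candidates v S F l" for A
    unfolding M_def using that by (intro Max_ge) auto
  have down: "B \<in> F" if "A \<in> F" "B \<subseteq> A" for A B
    using assms(5) that by (auto simp: downward_closed_def)
  have strictM: "set_profit v S g A \<le> M" if "A \<in> F" "A \<subseteq> strict_upper_items v S l" for A
    using that by (intro candM) (auto simp: candidates_def)
  obtain X i where X: "X \<in> F" "X \<subseteq> upper_items v S l" "l $ i \<le> grad g (S *v indvec X) $ i"
    using assms(8) by (auto simp: P2_def)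
  \<comment> \<open>The empty set is a candidate, hence \<open>0 \<le> M\<close>; this later covers
    the option of omitting an item.\<close>
  have "set_profit v S g {} = 0"
    by (simp add: profit_def indvec_def g0 zero_vec_def[symmetric])
  then have M0: "0 \<le> M" using strictM[of "{}"] down[OF X(1)] by simp

  define c where "c = (\<chi> e. v $ e - l \<bullet> column e S)"
  have c: "c \<bullet> x = v \<bullet> x - l \<bullet> (S *v x)" for x
    unfolding inner_matrix_vector_mult
    by (simp add: c_def inner_vec_def[of v x] inner_vec_def[of _ x] sum_subtractf left_diff_distrib)

  have reduced: "c \<bullet> x' \<le> M"
  proof (rule linear_le_on_convex_hull[OF _ assms(10)])
    fix y assume "y \<in> indvec ` F"
    then obtain A where A: "y = indvec A" "A \<in> F" by auto
    \<comment> \<open>Discarding items with nonpositive entry of \<open>c\<close> cannot lower the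
      reduced value, and (P1') applies to what remains.\<close>
    let ?B = "A \<inter> strict_upper_items v S l"
    have B: "?B \<in> F" using down A by blast
    have "c \<bullet> y = sum (($) c) A" by (simp add: A inner_indvec)
    also have "\<dots> = sum (($) c) ?B + sum (($) c) (A - strict_upper_items v S l)"
      by (rule sum.Int_Diff) simp
    also have "\<dots> \<le> sum (($) c) ?B"
      by (auto simp: c_def strict_upper_items_def intro!: sum_nonpos)
    also have "\<dots> = c \<bullet> indvec ?B" by (simp add: inner_indvec)
    also have "\<dots> \<le> set_profit v S g ?B"
      unfolding c using assms(7) B load
      by (intro profit_ge_reduced_value conv gd g0) (auto simp: P1_def)
    also have "\<dots> \<le> M" using B by (intro strictM) auto
    finally show "c \<bullet> y \<le> M" .
  qed

  \<comment> \<open>Stated for fractional \<open>x\<close>, because the crossing point may contain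
    only a part of an item.\<close>
  have upper_value: "l \<bullet> (S *v x) \<le> v \<bullet> x"
    if "0 \<le> x" "\<And>e. x $ e \<noteq> 0 \<Longrightarrow> e \<in> upper_items v S l" for x
  proof -
    have "0 \<le> c \<bullet> x"
      unfolding inner_vec_def
    proof (rule sum_nonneg)
      fix e
      show "0 \<le> c $ e \<bullet> x $ e"
        using that(1) that(2)[of e]
        by (cases "x $ e = 0") (auto simp: c_def upper_items_def less_eq_vec_def)
    qed
    then show ?thesis by (simp add: c)
  qed

  \<comment> \<open>One index suffices, since (P3') makes all conjugates equal. The factor 2 pays
    for a feasible set and one further item.\<close>
  have "\<exists>j. axis_conj g j (l $ j) \<le> 2 * M"
  proof (cases "X \<subseteq> strict_upper_items v S l")
    case True
    then have "grad g (S *v indvec X) \<le> l" using assms(7) X by (auto simp: P1_def)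
    \<comment> \<open>Here both slope conditions already hold at the load of
      \<open>X\<close>.\<close>
    then have "axis_conj g i (l $ i) \<le> l \<bullet> (S *v indvec X) - g (S *v indvec X)"
      using X load
      by (intro axis_conj_le radial_slope_leI axis_slope_geI conv gd) auto
    also have "\<dots> \<le> set_profit v S g X"
      using X upper_value[OF indvec_nonneg, of X]
      by (auto simp: profit_def indvec_def indicator_def split: if_splits)
    also have "\<dots> \<le> M" using True X by (intro strictM)
    finally show ?thesis using M0 by (intro exI[of _ i]) simp
  next
    case False
    let ?ties = "{e. v $ e = l \<bullet> column e S}"
    obtain e where e: "e \<in> X" "e \<notin> strict_upper_items v S l" using False by blast
    then have eU: "e \<in> upper_items v S l" and "e \<in> ?ties"
      using X by (auto simp: upper_items_def strict_upper_items_def)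
    \<comment> \<open>General position applies because \<open>l\<close> lies on the curve; so
      \<open>e\<close> is the only tie and \<open>X - {e}\<close> is strictly upper.\<close>
    moreover have "card ?ties \<le> 1"
      using assms(4,6) by (auto simp: standing_assumption_def general_position_def)
    ultimately have ties: "e' = e" if "e' \<in> ?ties" for e'
      using that card_le_Suc0_iff_eq[of ?ties] by auto
    define A where "A = X - {e}"
    have A: "A \<in> F" "{e} \<in> F" using e down[OF X(1)] by (auto simp: A_def)
    have AU: "A \<subseteq> strict_upper_items v S l"
    proof
      fix e' assume "e' \<in> A"
      then show "e' \<in> strict_upper_items v S l"
        using X ties[of e'] unfolding A_def upper_items_def strict_upper_items_def by force
    qed
    have "X = insert e A" "e \<notin> A" using e by (auto simp: A_def)
    then have SX: "S *v indvec X = S *v indvec A + column e S"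
      by (simp add: indvec_insert matrix_vector_right_distrib matrix_vector_mult_basis)
    have "grad g (S *v indvec A) \<le> l" using assms(7) A AU by (auto simp: P1_def)
    then obtain t j where t: "t \<in> {0..1}"
      and rad: "radial_slope_le g l (S *v indvec A + t *\<^sub>R column e S)"
      and ax: "axis_slope_ge g l j (S *v indvec A + t *\<^sub>R column e S)"
      by (rule exists_slope_crossing[OF conv gd load sizes _ X(3)[unfolded SX]])
    define x where "x = indvec A + t *\<^sub>R axis e 1"
    have Sx: "S *v x = S *v indvec A + t *\<^sub>R column e S"
      by (simp add: x_def matrix_vector_right_distrib matrix_vector_mult_basis
          matrix_vector_mult_scaleR)
    have x0: "0 \<le> x" using t by (auto simp: x_def less_eq_vec_def indvec_def axis_def)
    have xU: "e' \<in> upper_items v S l" if "x $ e' \<noteq> 0" for e'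
      using that eU AU by (auto simp: x_def indvec_def axis_def indicator_def upper_items_def
          strict_upper_items_def split: if_splits)
    have "axis_conj g j (l $ j) \<le> l \<bullet> (S *v x) - g (S *v x)"
      using rad ax by (intro axis_conj_le conv gd matrix_vector_mult_orthant assms(2) x0)
        (auto simp: Sx)
    also have "\<dots> \<le> v \<bullet> x - g (S *v x)"
      using upper_value[OF x0 xU] by simp
    also have "\<dots> \<le> v \<bullet> x - (g (S *v indvec A) + g (t *\<^sub>R column e S))"
      unfolding Sx using t
      by (intro diff_left_mono supermodular_convex_superadditive conv sm g0 load orthant_scaleR sizes)
        auto
    also have "\<dots> = set_profit v S g A + (t * v $ e - g (t *\<^sub>R column e S))"
      by (simp add: profit_def x_def inner_add_right inner_axis)
    also have "\<dots> \<le> M + M"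
    proof (rule add_mono)
      show "set_profit v S g A \<le> M" using A AU by (intro strictM)
      \<comment> \<open>Some maximiser is an endpoint, so a fraction of \<open>e\<close> earns no
        more than omitting \<open>e\<close> or taking it whole.\<close>
      obtain \<theta> where "is_arg_max (\<lambda>\<theta>. \<theta> * v $ e - g (\<theta> *\<^sub>R column e S)) (\<lambda>\<theta>. \<theta> \<in> {0..1}) \<theta>"
        "\<theta> \<notin> {0<..<1}"
        using nexc[of e] unfolding exceptional_def by blast
      then have "\<theta> = 0 \<or> \<theta> = 1"
        "t * v $ e - g (t *\<^sub>R column e S) \<le> \<theta> * v $ e - g (\<theta> *\<^sub>R column e S)"
        using t by (auto simp: is_arg_max_def not_less)
      moreover have "v $ e - g (column e S) \<le> M"
        using candM[of "{e}"] A eU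
        by (simp add: candidates_def profit_def indvec_singleton inner_axis matrix_vector_mult_basis)
      ultimately show "t * v $ e - g (t *\<^sub>R column e S) \<le> M"
        using M0 g0 by auto
    qed
    finally show ?thesis by (intro exI[of _ j]) simp
  qed
  then obtain j where j: "axis_conj g j (l $ j) \<le> 2 * M" ..
  then have conj: "axis_conj g i (l $ i) \<le> 2 * M" for i
    using assms(9) unfolding P3_def by metis

  have "convex {x :: real^'n. 0 \<le> x}"
    using convex_orthant by (simp add: orthant_def)
  then have "convex hull (indvec ` F) \<subseteq> {x. 0 \<le> x}"
    by (intro hull_minimal) (auto simp: indvec_nonneg)
  then have "S *v x' \<in> orthant"
    using assms(10) by (intro matrix_vector_mult_orthant assms(2)) auto
  then have "l \<bullet> (S *v x') - g (S *v x') \<le> (\<Sum>i\<in>UNIV. axis_conj g i (l $ i))"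
    by (rule dual_bound[OF g])
  also have "\<dots> \<le> (\<Sum>i\<in>(UNIV::'d set). 2 * M)"
    by (intro sum_mono conj)
  \<comment> \<open>The reduced value contributes \<open>M\<close>, and each of the
    \<open>CARD('d)\<close> conjugates at most \<open>2 * M\<close>.\<close>
  finally have "profit v S g x' \<le> M + CARD('d) * (2 * M)"
    using reduced by (simp add: profit_def c)
  also have "\<dots> = M * (2 * real CARD('d) + 1)" by (simp add: algebra_simps)
  finally show ?thesis
    unfolding M_def[symmetric] by (simp add: pos_divide_le_eq)
qed

end
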